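(* Let $F:\mathbb{R}^d\to\mathbb{R}^d$ be monotone and $L$-Lipschitz ($L>0$), and let $u^*\in\mathbb{R}^d$ satisfy $F(u^* )=0$. Let $(u_k)_{k\ge0}$ be the iterates generated by OGDA$+$ with starting point $u_0=u_{-1}\in\mathbb{R}^d$, parameter $0<\gamma\le1$ and step size $a>0$ such that $$aL=\frac{2-\gamma}{2+\gamma}-\varepsilon\quad\text{for some }\varepsilon>0 .$$ Then, for all $k\ge1$, $$\min_{i=0,\dots,k-1}\Vert F(u_i)\Vert^2\le\frac{2}{k\,a^2\,\gamma^2\,\varepsilon}\,\Vert u_0+aF(u_0)-u^*\Vert^2 .$$ In particular, one can choose $\gamma=1$ and any $a<\frac{1}{3L}$.
   Context: $\langle\cdot,\cdot\rangle$ and $\Vert\cdot\Vert$ are the Euclidean inner product and norm on $\mathbb{R}^d$. $F$ is monotone if $\langle F(u)-F(v),u-v\rangle\ge0$ for all $u,v\in\mathbb{R}^d$. OGDA$+$: given a starting point $u_0=u_{-1}\in\mathbb{R}^d$, a step size $a>0$ and a parameter $0<\gamma\le1$, for $k=0,1,\dots$ set $u_{k+1}=u_k-a\big((1+\gamma)F(u_k)-F(u_{k-1})\big)$. *)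

theory Defs
  imports "HOL-Analysis.Analysis"
begin

definition monotone_operator :: "('a::real_inner \<Rightarrow> 'a) \<Rightarrow> bool" where
  "monotone_operator F \<longleftrightarrow> (\<forall>u v. 0 \<le> (F u - F v) \<bullet> (u - v))"

(* The iterates u_0, u_1, ... of OGDA+ with operator F, step size a, parameter g and starting
   point u0. The convention u_{-1} = u_0 enters only the step k = 0, which is the second equation. *)
fun ogda_plus :: "('a::real_vector \<Rightarrow> 'a) \<Rightarrow> real \<Rightarrow> real \<Rightarrow> 'a \<Rightarrow> nat \<Rightarrow> 'a" where
  "ogda_plus F a g u0 0 = u0"
| "ogda_plus F a g u0 (Suc 0) = u0 - a *\<^sub>R ((1 + g) *\<^sub>R F u0 - F u0)"
| "ogda_plus F a g u0 (Suc (Suc k)) =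
     ogda_plus F a g u0 (Suc k)
       - a *\<^sub>R ((1 + g) *\<^sub>R F (ogda_plus F a g u0 (Suc k)) - F (ogda_plus F a g u0 k))"

end

theory Submission imports Defs begin

text \<open>
  With \<open>u\<^sub>-\<^sub>1 = u\<^sub>0\<close>, put \<open>g\<^sub>k = a F(u\<^sub>k)\<close>, \<open>e\<^sub>k = g\<^sub>k - g\<^sub>k\<^sub>-\<^sub>1\<close>,
  \<open>w\<^sub>k = u\<^sub>k + g\<^sub>k\<^sub>-\<^sub>1\<close> and \<open>r = a L\<close>. OGDA+ becomes the explicit step
  \<open>w\<^sub>k\<^sub>+\<^sub>1 = w\<^sub>k - \<gamma> g\<^sub>k\<close>, and monotonicity against the zero \<open>u\<^sup>*\<close> gives
  \<open>|w\<^sub>k\<^sub>+\<^sub>1 - u\<^sup>*|\<^sup>2 \<le> |w\<^sub>k - u\<^sup>*|\<^sup>2 + \<gamma> (|e\<^sub>k|\<^sup>2 - (1 - \<gamma>) |g\<^sub>k|\<^sup>2 - |g\<^sub>k\<^sub>-\<^sub>1|\<^sup>2)\<close>.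
  Since \<open>u\<^sub>k\<^sub>+\<^sub>1 - u\<^sub>k = -(\<gamma> g\<^sub>k + e\<^sub>k)\<close>, the Lipschitz property bounds \<open>|e\<^sub>k\<^sub>+\<^sub>1|\<^sup>2\<close> by
  \<open>r |e\<^sub>k|\<^sup>2\<close> plus a multiple of \<open>|g\<^sub>k|\<^sup>2\<close>. The step size condition makes this multiple so
  small that the terms \<open>|e\<^sub>k|\<^sup>2\<close> are absorbed and \<open>\<gamma>/2 \<Sum> |g\<^sub>i|\<^sup>2 \<le> |w\<^sub>0 - u\<^sup>*|\<^sup>2\<close> remains.
\<close>

text \<open>The truncated subtraction \<open>0 - 1 = 0\<close> encodes the convention \<open>u\<^sub>-\<^sub>1 = u\<^sub>0\<close>.\<close>

lemma ogda_plus_Suc: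
  "ogda_plus F a \<gamma> u0 (Suc k) = ogda_plus F a \<gamma> u0 k
     - a *\<^sub>R ((1 + \<gamma>) *\<^sub>R F (ogda_plus F a \<gamma> u0 k) - F (ogda_plus F a \<gamma> u0 (k - 1)))"
  by (cases k) simp_all

text \<open>The polarisation identity \<open>2 * (g \<bullet> p) = |g|^2 + |p|^2 - |g - p|^2\<close>
  makes the gap between the two sides exactly
  \<open>2 * \<gamma> * (g \<bullet> (u - z))\<close>.\<close>

lemma power2_norm_diff_reflected_step:
  fixes u g p z :: "'a::real_inner"
  assumes "0 \<le> \<gamma>" and "0 \<le> g \<bullet> (u - z)"
  shows "(norm (u + p - \<gamma> *\<^sub>R g - z))\<^sup>2
    \<le> (norm (u + p - z))\<^sup>2 + \<gamma> * ((norm (g - p))\<^sup>2 - (1 - \<gamma>) * (norm g)\<^sup>2 - (norm p)\<^sup>2)"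
proof -
  have "(norm (u + p - z))\<^sup>2 + \<gamma> * ((norm (g - p))\<^sup>2 - (1 - \<gamma>) * (norm g)\<^sup>2 - (norm p)\<^sup>2)
      - (norm (u + p - \<gamma> *\<^sub>R g - z))\<^sup>2 = 2 * (\<gamma> * (g \<bullet> (u - z)))"
    unfolding power2_norm_eq_inner
    by (simp add: inner_diff_left inner_diff_right inner_add_left inner_add_right
        inner_commute algebra_simps)
  moreover have "0 \<le> \<gamma> * (g \<bullet> (u - z))"
    using assms by simp
  ultimately show ?thesis by linarith
qed

text \<open>Young's inequality, cleared of denominators: the gap is a perfect square. These weights
  are chosen so that \<open>r^2 * (x + y)^2\<close> costs exactly \<open>r * y^2\<close> in
  \<open>y\<close>.\<close>

lemma power2_add_le_weighted:
  fixes r x y :: real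
  assumes "0 \<le> r" and "r \<le> 1"
  shows "r * (1 - r) * (x + y)\<^sup>2 \<le> r * x\<^sup>2 + (1 - r) * y\<^sup>2"
proof -
  have "r * x\<^sup>2 + (1 - r) * y\<^sup>2 - r * (1 - r) * (x + y)\<^sup>2 = (r * x - (1 - r) * y)\<^sup>2"
    by (simp add: power2_eq_square algebra_simps)
  then show ?thesis
    by (metis diff_ge_0_iff_ge zero_le_power2)
qed

text \<open>The bound \<open>r \<gamma> \<le> (1 - \<gamma>/2) (1 - r)\<close> is the step size condition
  \<open>r \<le> (2 - \<gamma>) / (2 + \<gamma>)\<close> cleared of denominators.\<close>

lemma contraction_bound:
  fixes r \<gamma> x y z :: real
  assumes "0 < r" "r < 1" "0 < \<gamma>" "\<gamma> \<le> 1"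
    and step: "r * \<gamma> \<le> (1 - \<gamma> / 2) * (1 - r)"
    and z: "0 \<le> z" "z \<le> r * (\<gamma> * x + y)"
  shows "z\<^sup>2 \<le> r * y\<^sup>2 + (1 - r) * (3 / 2 - \<gamma>) * x\<^sup>2"
proof -
  have "(r * \<gamma>)\<^sup>2 \<le> ((1 - \<gamma> / 2) * (1 - r))\<^sup>2"
    using step assms by (intro power_mono) auto
  also have "\<dots> = (1 - \<gamma> / 2)\<^sup>2 * (1 - r)\<^sup>2"
    by (simp add: power_mult_distrib)
  also have "\<dots> \<le> (3 / 2 - \<gamma>) * (1 - r)\<^sup>2"
  proof (rule mult_right_mono)
    have "\<gamma>\<^sup>2 \<le> 1"
      using assms by (simp add: power_le_one)
    then show "(1 - \<gamma> / 2)\<^sup>2 \<le> 3 / 2 - \<gamma>"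
      by (simp add: power2_eq_square algebra_simps)
  qed simp
  finally have *: "(r * \<gamma>)\<^sup>2 \<le> (3 / 2 - \<gamma>) * (1 - r)\<^sup>2" .
  have "(1 - r) * z\<^sup>2 \<le> (1 - r) * (r * (\<gamma> * x + y))\<^sup>2"
    using z assms by (intro mult_left_mono power_mono) auto
  also have "\<dots> = r * (r * (1 - r) * (\<gamma> * x + y)\<^sup>2)"
    by (simp add: power2_eq_square)
  also have "\<dots> \<le> r * (r * (\<gamma> * x)\<^sup>2 + (1 - r) * y\<^sup>2)"
    using assms by (intro mult_left_mono power2_add_le_weighted) auto
  also have "\<dots> = (r * \<gamma>)\<^sup>2 * x\<^sup>2 + (1 - r) * (r * y\<^sup>2)"
    by (simp add: power2_eq_square algebra_simps)
  also have "\<dots> \<le> (3 / 2 - \<gamma>) * (1 - r)\<^sup>2 * x\<^sup>2 + (1 - r) * (r * y\<^sup>2)"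
    using * by (intro add_right_mono mult_right_mono) auto
  also have "\<dots> = (1 - r) * (r * y\<^sup>2 + (1 - r) * (3 / 2 - \<gamma>) * x\<^sup>2)"
    by (simp add: power2_eq_square field_simps)
  finally show ?thesis
    using assms by simp
qed

text \<open>A Lyapunov estimate, multiplied by \<open>1 - r\<close> with \<open>r = a * L\<close> to
  avoid division. The weight \<open>c = r / (1 - r)\<close> of \<open>|e_k|^2\<close> solves
  \<open>r * (1 + c) = c\<close>, so the contraction of \<open>e\<close> reproduces it at every
  step.\<close>

lemma ogda_plus_energy:
  fixes F :: "'a::real_inner \<Rightarrow> 'a" and u :: "nat \<Rightarrow> 'a"
  assumes mono: "monotone_operator F" and lip: "L-lipschitz_on UNIV F" and zero: "F z = 0"
    and pos: "0 < L" "0 < a" "0 < \<gamma>" "\<gamma> \<le> 1"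
    and r_lt: "a * L < 1" and step: "a * L * \<gamma> \<le> (1 - \<gamma> / 2) * (1 - a * L)"
    and u_Suc: "\<And>k. u (Suc k) = u k - a *\<^sub>R ((1 + \<gamma>) *\<^sub>R F (u k) - F (u (k - 1)))"
  defines "g \<equiv> \<lambda>k. a *\<^sub>R F (u k)"
  shows "(1 - a * L) * ((norm (u (Suc k) + g k - z))\<^sup>2 + \<gamma> * (1 - \<gamma>) * (norm (g k))\<^sup>2
      + \<gamma> / 2 * (\<Sum>i<k. (norm (g i))\<^sup>2)) + \<gamma> * (a * L) * (norm (g k - g (k - 1)))\<^sup>2
    \<le> (1 - a * L) * (norm (u 0 + g 0 - z))\<^sup>2"
proof -
  define D where "D k = (norm (u k + g (k - 1) - z))\<^sup>2" for k
  define r where "r = a * L"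
  have r: "0 < r" "r < 1"
    using pos r_lt by (simp_all add: r_def)
  have w_Suc: "u (Suc k) + g k = u k + g (k - 1) - \<gamma> *\<^sub>R g k" for k
    by (simp add: u_Suc g_def algebra_simps)
  have inner: "0 \<le> g k \<bullet> (u k - z)" for k
    using mono zero pos unfolding monotone_operator_def g_def
    by (metis diff_zero inner_scaleR_left less_imp_le mult_nonneg_nonneg)
  have descent: "D (Suc k) \<le> D k + \<gamma> * ((norm (g k - g (k - 1)))\<^sup>2
      - (1 - \<gamma>) * (norm (g k))\<^sup>2 - (norm (g (k - 1)))\<^sup>2)" for k
    using power2_norm_diff_reflected_step[of \<gamma> "g k" "u k" z "g (k - 1)"] pos inner
    by (simp add: D_def w_Suc)
  have e_Suc: "(norm (g (Suc k) - g k))\<^sup>2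
      \<le> r * (norm (g k - g (k - 1)))\<^sup>2 + (1 - r) * (3 / 2 - \<gamma>) * (norm (g k))\<^sup>2" for k
  proof (rule contraction_bound[OF r])
    have "norm (g (Suc k) - g k) = a * norm (F (u (Suc k)) - F (u k))"
      using pos by (simp add: g_def flip: scaleR_diff_right)
    also have "\<dots> \<le> a * (L * norm (u (Suc k) - u k))"
      using lip pos by (intro mult_left_mono) (auto simp: lipschitz_on_def dist_norm)
    also have "u (Suc k) - u k = - (\<gamma> *\<^sub>R g k + (g k - g (k - 1)))"
      by (simp add: u_Suc g_def algebra_simps)
    also have "a * (L * norm \<dots>) \<le> r * (\<gamma> * norm (g k) + norm (g k - g (k - 1)))"
      using r pos norm_triangle_ineq[of "\<gamma> *\<^sub>R g k" "g k - g (k - 1)"]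
      unfolding norm_minus_cancel by (simp add: r_def)
    finally show "norm (g (Suc k) - g k) \<le> r * (\<gamma> * norm (g k) + norm (g k - g (k - 1)))" .
  qed (use pos step in \<open>auto simp: r_def\<close>)
  have "(1 - r) * (D (Suc k) + \<gamma> * (1 - \<gamma>) * (norm (g k))\<^sup>2
      + \<gamma> / 2 * (\<Sum>i<k. (norm (g i))\<^sup>2)) + \<gamma> * r * (norm (g k - g (k - 1)))\<^sup>2
    \<le> (1 - r) * D 0"
  proof (induction k)
    \<comment> \<open>Here \<open>0 - 1 = 0\<close> gives \<open>g_{-1} = g_0\<close>, hence
      \<open>e_0 = 0\<close>, and \<open>D 0\<close> is the squared distance of
      \<open>u 0 + g 0\<close> from \<open>z\<close>.\<close>
    case 0
    have "0 \<le> \<gamma> * (norm (g 0))\<^sup>2"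
      using pos by simp
    then have "D (Suc 0) + \<gamma> * (1 - \<gamma>) * (norm (g 0))\<^sup>2 \<le> D 0"
      using descent[of 0] by (simp add: algebra_simps)
    then show ?case
      using r by simp
  next
    case (Suc k)
    define G G' S E E' where "G = (norm (g k))\<^sup>2" and "G' = (norm (g (Suc k)))\<^sup>2"
      and "S = (\<Sum>i<k. (norm (g i))\<^sup>2)" and "E = (norm (g k - g (k - 1)))\<^sup>2"
      and "E' = (norm (g (Suc k) - g k))\<^sup>2"
    have "(1 - r) * D (Suc (Suc k)) \<le> (1 - r) * (D (Suc k) + \<gamma> * (E' - (1 - \<gamma>) * G' - G))"
      using descent[of "Suc k"] r by (intro mult_left_mono) (auto simp: G_def G'_def E'_def)
    \<comment> \<open>The constant is \<open>3/2 - \<gamma> = (1 - \<gamma>) + 1/2\<close>: the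
      energy at \<open>k\<close> supplies \<open>1 - \<gamma>\<close>, and half of the
      \<open>- G\<close> from \<open>descent\<close> supplies \<open>1/2\<close>. The other half of
      \<open>- G\<close> pays for the new summand of the sum.\<close>
    moreover have "\<gamma> * E' \<le> \<gamma> * (r * E + (1 - r) * (3 / 2 - \<gamma>) * G)"
      using e_Suc[of k] pos by (intro mult_left_mono) (auto simp: G_def E_def E'_def)
    ultimately have "(1 - r) * (D (Suc (Suc k)) + \<gamma> * (1 - \<gamma>) * G' + \<gamma> / 2 * (S + G)) + \<gamma> * r * E'
      \<le> (1 - r) * (D (Suc k) + \<gamma> * (1 - \<gamma>) * G + \<gamma> / 2 * S) + \<gamma> * r * E"
      by (simp add: field_simps)
    also have "\<dots> \<le> (1 - r) * D 0"
      using Suc.IH by (simp add: G_def S_def E_def)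
    finally show ?case
      by (simp add: G_def G'_def S_def E'_def)
  qed
  then show ?thesis
    by (simp add: D_def r_def)
qed

text \<open>The estimate is uniform up to the borderline step size; no \<epsilon> enters.\<close>

lemma ogda_plus_sum_bound:
  fixes F :: "'a::real_inner \<Rightarrow> 'a"
  assumes "monotone_operator F" "L-lipschitz_on UNIV F" "F z = 0"
    and pos: "0 < L" "0 < a" "0 < \<gamma>" "\<gamma> \<le> 1" and aL: "a * L \<le> (2 - \<gamma>) / (2 + \<gamma>)"
  shows "a\<^sup>2 * \<gamma> * (\<Sum>i<k. (norm (F (ogda_plus F a \<gamma> u0 i)))\<^sup>2)
    \<le> 2 * (norm (u0 + a *\<^sub>R F u0 - z))\<^sup>2"
proof -
  define u where "u = ogda_plus F a \<gamma> u0"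
  define S where "S = (\<Sum>i<k. (norm (a *\<^sub>R F (u i)))\<^sup>2)"
  define R where "R = (norm (u (Suc k) + a *\<^sub>R F (u k) - z))\<^sup>2
    + \<gamma> * (1 - \<gamma>) * (norm (a *\<^sub>R F (u k)))\<^sup>2"
  have "(2 - \<gamma>) / (2 + \<gamma>) < 1"
    using pos by (simp add: field_simps)
  then have lt: "a * L < 1"
    using aL by linarith
  have step: "a * L * \<gamma> \<le> (1 - \<gamma> / 2) * (1 - a * L)"
    using aL pos by (simp add: field_simps)
  have "0 \<le> R" "0 \<le> \<gamma> * (a * L) * (norm (a *\<^sub>R F (u k) - a *\<^sub>R F (u (k - 1))))\<^sup>2"
    using pos by (simp_all add: R_def)
  moreover have "(1 - a * L) * (R + \<gamma> / 2 * S)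
      + \<gamma> * (a * L) * (norm (a *\<^sub>R F (u k) - a *\<^sub>R F (u (k - 1))))\<^sup>2
    \<le> (1 - a * L) * (norm (u 0 + a *\<^sub>R F (u 0) - z))\<^sup>2"
    unfolding R_def S_def
    by (rule ogda_plus_energy[OF assms(1-7) lt step]) (simp add: u_def ogda_plus_Suc)
  ultimately have "(1 - a * L) * (R + \<gamma> / 2 * S)
      \<le> (1 - a * L) * (norm (u 0 + a *\<^sub>R F (u 0) - z))\<^sup>2"
    by linarith
  then have "R + \<gamma> / 2 * S \<le> (norm (u 0 + a *\<^sub>R F (u 0) - z))\<^sup>2"
    using lt by simp
  with \<open>0 \<le> R\<close> have "\<gamma> * S \<le> 2 * (norm (u0 + a *\<^sub>R F u0 - z))\<^sup>2"
    by (simp add: u_def)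
  moreover have "S = a\<^sup>2 * (\<Sum>i<k. (norm (F (u i)))\<^sup>2)"
    by (simp add: S_def power_mult_distrib sum_distrib_left)
  ultimately show ?thesis
    by (simp add: u_def mult_ac)
qed

lemma Min_le_average:
  fixes f :: "nat \<Rightarrow> real"
  assumes "1 \<le> k"
  shows "real k * (MIN i\<in>{0..k - 1}. f i) \<le> (\<Sum>i<k. f i)"
proof -
  have "{0..k - 1} = {..<k}"
    using assms by auto
  then show ?thesis
    using sum_bounded_below[of "{..<k}" "MIN i\<in>{..<k}. f i" f] by simp
qed

lemma ogda_plus_min_bound:
  fixes F :: "'a::real_inner \<Rightarrow> 'a"
  assumes F: "monotone_operator F" "L-lipschitz_on UNIV F" "F z = 0"
    and pos: "0 < L" "0 < a" "0 < \<gamma>" "\<gamma> \<le> 1" "0 < \<epsilon>"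
    and aL: "a * L = (2 - \<gamma>) / (2 + \<gamma>) - \<epsilon>" and k: "1 \<le> k"
  shows "(MIN i\<in>{0..k - 1}. (norm (F (ogda_plus F a \<gamma> u0 i)))\<^sup>2)
    \<le> 2 / (real k * a\<^sup>2 * \<gamma>\<^sup>2 * \<epsilon>) * (norm (u0 + a *\<^sub>R F u0 - z))\<^sup>2"
proof -
  let ?M = "MIN i\<in>{0..k - 1}. (norm (F (ogda_plus F a \<gamma> u0 i)))\<^sup>2"
  let ?D = "(norm (u0 + a *\<^sub>R F u0 - z))\<^sup>2"
  have "(2 - \<gamma>) / (2 + \<gamma>) \<le> 1"
    using pos by (simp add: field_simps)
  moreover have "0 < a * L"
    using pos by simp
  \<comment> \<open>Averaging the sum bound gives the constant
    \<open>2 / (k * a^2 * \<gamma>)\<close>. Since \<open>\<gamma> * \<epsilon> \<le> 1\<close>, the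
    additional factor \<open>1 / (\<gamma> * \<epsilon>)\<close> only weakens it.\<close>
  ultimately have "\<epsilon> \<le> 1"
    using aL by linarith
  then have "\<gamma> * \<epsilon> \<le> 1"
    using pos by (intro mult_le_one) auto
  have "a\<^sup>2 * \<gamma> * (real k * ?M) \<le> a\<^sup>2 * \<gamma> * (\<Sum>i<k. (norm (F (ogda_plus F a \<gamma> u0 i)))\<^sup>2)"
    using pos by (intro mult_left_mono Min_le_average[OF k]) auto
  also have "\<dots> \<le> 2 * ?D"
    using pos aL by (intro ogda_plus_sum_bound[OF F]) auto
  finally have "\<gamma> * \<epsilon> * (a\<^sup>2 * \<gamma> * (real k * ?M)) \<le> \<gamma> * \<epsilon> * (2 * ?D)"
    using pos by (intro mult_left_mono) auto
  also have "\<dots> \<le> 1 * (2 * ?D)"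
    using \<open>\<gamma> * \<epsilon> \<le> 1\<close> by (intro mult_right_mono) auto
  finally have "?M * (real k * a\<^sup>2 * \<gamma>\<^sup>2 * \<epsilon>) \<le> 2 * ?D"
    by (simp add: power2_eq_square mult_ac)
  moreover have "0 < real k * a\<^sup>2 * \<gamma>\<^sup>2 * \<epsilon>"
    using pos k by simp
  ultimately show ?thesis
    by (simp add: pos_le_divide_eq)
qed

theorem theorem3p2:
  fixes F :: "real ^ 'n \<Rightarrow> real ^ 'n"
    and L :: real
    and ustar u0 :: "real ^ 'n"
  assumes "monotone_operator F"
    and "0 < L"
    and "L-lipschitz_on UNIV F"
    and "F ustar = 0"
  shows "(\<forall>\<gamma> a \<epsilon> :: real. 0 < \<gamma> \<longrightarrow> \<gamma> \<le> 1 \<longrightarrow> 0 < a \<longrightarrow> 0 < \<epsilon> \<longrightarrow>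
           a * L = (2 - \<gamma>) / (2 + \<gamma>) - \<epsilon> \<longrightarrow>
           (\<forall>k::nat. 1 \<le> k \<longrightarrow>
             (MIN i\<in>{0..k - 1}. (norm (F (ogda_plus F a \<gamma> u0 i)))\<^sup>2)
               \<le> 2 / (real k * a\<^sup>2 * \<gamma>\<^sup>2 * \<epsilon>) * (norm (u0 + a *\<^sub>R F u0 - ustar))\<^sup>2)) \<and>
         (\<forall>a::real. 0 < a \<longrightarrow> a < 1 / (3 * L) \<longrightarrow>
           (\<exists>\<epsilon>>0. a * L = (2 - 1) / (2 + 1) - \<epsilon> \<and>
             (\<forall>k::nat. 1 \<le> k \<longrightarrow>
               (MIN i\<in>{0..k - 1}. (norm (F (ogda_plus F a 1 u0 i)))\<^sup>2)
                 \<le> 2 / (real k * a\<^sup>2 * 1\<^sup>2 * \<epsilon>) * (norm (u0 + a *\<^sub>R F u0 - ustar))\<^sup>2)))"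
proof (intro conjI allI impI)
  fix \<gamma> a \<epsilon> :: real and k :: nat
  assume "0 < \<gamma>" "\<gamma> \<le> 1" "0 < a" "0 < \<epsilon>" "a * L = (2 - \<gamma>) / (2 + \<gamma>) - \<epsilon>" "1 \<le> k"
  then show "(MIN i\<in>{0..k - 1}. (norm (F (ogda_plus F a \<gamma> u0 i)))\<^sup>2)
      \<le> 2 / (real k * a\<^sup>2 * \<gamma>\<^sup>2 * \<epsilon>) * (norm (u0 + a *\<^sub>R F u0 - ustar))\<^sup>2"
    using assms by (intro ogda_plus_min_bound)
next
  fix a :: real
  assume a: "0 < a" "a < 1 / (3 * L)"
  \<comment> \<open>For \<gamma> = 1 the threshold is 1/3, which forces this \<epsilon>; it is
    positive because \<open>a < 1 / (3 * L)\<close>.\<close>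
  define \<epsilon> where "\<epsilon> = 1 / 3 - a * L"
  have \<epsilon>: "0 < \<epsilon>" "a * L = (2 - 1) / (2 + 1) - \<epsilon>"
    using a \<open>0 < L\<close> by (simp_all add: \<epsilon>_def field_simps)
  show "\<exists>\<epsilon>>0. a * L = (2 - 1) / (2 + 1) - \<epsilon> \<and>
      (\<forall>k::nat. 1 \<le> k \<longrightarrow>
        (MIN i\<in>{0..k - 1}. (norm (F (ogda_plus F a 1 u0 i)))\<^sup>2)
          \<le> 2 / (real k * a\<^sup>2 * 1\<^sup>2 * \<epsilon>) * (norm (u0 + a *\<^sub>R F u0 - ustar))\<^sup>2)"
    using assms a \<epsilon> by (intro exI[of _ \<epsilon>] conjI allI impI ogda_plus_min_bound) auto
qed

end
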